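(* Let $\Gamma$ be a countable bipartite graph. Then (i) there exists an idempotent endomorphism $f$ of the countable universal bipartite graph $B$ such that $\operatorname{im} f\cong\Gamma$ if and only if $\Gamma$ is algebraically closed; (ii) if $\Gamma$ is algebraically closed and is not isomorphic to the finite complete bipartite graph $K_{1,1}$, then there are $2^{\aleph_0}$ idempotent endomorphisms $f$ of $B$ such that $\operatorname{im} f\cong\Gamma$; (iii) if $\Gamma\cong K_{1,1}$, there are $\aleph_0$ idempotent endomorphisms $f$ of $B$ such that $\operatorname{im} f\cong\Gamma$.
   Context: A bipartite graph is a relational structure $(V,E,P)$ where $E$ is an irreflexive symmetric binary relation on $V$, $P=(V_0\times V_0)\cup(V_1\times V_1)$ for some partition $V=V_0\,\dot\cup\,V_1$, and $(u,v)\in E$ implies $(u,v)\notin P$. Homomorphisms preserve $E$ and $P$; isomorphisms are bijections whose inverses are homomorphisms (they may swap parts). A bipartite graph is algebraically closed if for every finite set of vertices that are pairwise $P$-related (all in one part) there exists a vertex adjacent to each of them. The countable universal bipartite graph $B$ is the Fraïssé limit of the finite bipartite graphs in this sense. For an endomorphism $f$ of $B=(V,E,P)$, $\operatorname{im} f=(Vf,Ef,P\cap(Vf\times Vf))$. $K_{1,1}$ is the bipartite graph with one vertex in each part joined by an edge. *)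

theory Defs
  imports Main "HOL-Library.FuncSet" "HOL-Library.Countable_Set" "HOL-Library.Equipollence"
begin

record 'a ep_struct =
  verts :: "'a set"
  edges :: "('a \<times> 'a) set"
  parts :: "('a \<times> 'a) set"

definition structure_on :: "'a ep_struct \<Rightarrow> bool" where
  "structure_on G \<longleftrightarrow> edges G \<subseteq> verts G \<times> verts G \<and> parts G \<subseteq> verts G \<times> verts G"

text \<open>A part may be empty, so that the class is closed under induced substructures
  (for example, a single vertex).\<close>

definition bipartite_graph :: "'a ep_struct \<Rightarrow> bool" where
  "bipartite_graph G \<longleftrightarrow>
     structure_on G \<and> irrefl (edges G) \<and> sym (edges G) \<and>
     (\<exists>V0 V1. verts G = V0 \<union> V1 \<and> V0 \<inter> V1 = {} \<and> parts G = (V0 \<times> V0) \<union> (V1 \<times> V1)) \<and>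
     (\<forall>u v. (u, v) \<in> edges G \<longrightarrow> (u, v) \<notin> parts G)"

definition is_hom :: "'a ep_struct \<Rightarrow> 'b ep_struct \<Rightarrow> ('a \<Rightarrow> 'b) \<Rightarrow> bool" where
  "is_hom G H f \<longleftrightarrow>
     f \<in> verts G \<rightarrow> verts H \<and>
     (\<forall>u v. (u, v) \<in> edges G \<longrightarrow> (f u, f v) \<in> edges H) \<and>
     (\<forall>u v. (u, v) \<in> parts G \<longrightarrow> (f u, f v) \<in> parts H)"

definition is_iso :: "'a ep_struct \<Rightarrow> 'b ep_struct \<Rightarrow> ('a \<Rightarrow> 'b) \<Rightarrow> bool" where
  "is_iso G H f \<longleftrightarrow>
     bij_betw f (verts G) (verts H) \<and> is_hom G H f \<and> is_hom H G (inv_into (verts G) f)"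

definition isomorphic :: "'a ep_struct \<Rightarrow> 'b ep_struct \<Rightarrow> bool" where
  "isomorphic G H \<longleftrightarrow> (\<exists>f. is_iso G H f)"

definition induced :: "'a ep_struct \<Rightarrow> 'a set \<Rightarrow> 'a ep_struct" where
  "induced G S =
     \<lparr>verts = S, edges = edges G \<inter> (S \<times> S), parts = parts G \<inter> (S \<times> S)\<rparr>"

text \<open>Up to isomorphism, every finite structure lives on a set of natural numbers, so the age
  is taken to consist of structures of that type.\<close>

definition age :: "'a ep_struct \<Rightarrow> nat ep_struct set" where
  "age G = {F. structure_on F \<and> finite (verts F) \<and>
               (\<exists>S \<subseteq> verts G. isomorphic F (induced G S))}"

definition homogeneous :: "'a ep_struct \<Rightarrow> bool" where
  "homogeneous G \<longleftrightarrow>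
     (\<forall>S T f. S \<subseteq> verts G \<and> T \<subseteq> verts G \<and> finite S \<and> finite T \<and>
        is_iso (induced G S) (induced G T) f \<longrightarrow>
        (\<exists>g. is_iso G G g \<and> (\<forall>x\<in>S. g x = f x)))"

definition fraisse_limit :: "nat ep_struct set \<Rightarrow> 'a ep_struct \<Rightarrow> bool" where
  "fraisse_limit K G \<longleftrightarrow>
     structure_on G \<and> countable (verts G) \<and> homogeneous G \<and> age G = K"

definition universal_bipartite_graph :: "'a ep_struct \<Rightarrow> bool" where
  "universal_bipartite_graph B \<longleftrightarrow>
     fraisse_limit {F. bipartite_graph F \<and> finite (verts F)} B"

text \<open>The case \<open>S = {}\<close> is included; it excludes the empty graph.\<close>

definition algebraically_closed :: "'a ep_struct \<Rightarrow> bool" where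
  "algebraically_closed G \<longleftrightarrow>
     (\<forall>S \<subseteq> verts G. finite S \<and> (\<forall>x\<in>S. \<forall>y\<in>S. (x, y) \<in> parts G) \<longrightarrow>
        (\<exists>v\<in>verts G. \<forall>x\<in>S. (x, v) \<in> edges G))"

text \<open>Endomorphisms are counted below, so they are fixed to \<open>undefined\<close> off the vertex set.\<close>

definition idempotent_endos :: "'a ep_struct \<Rightarrow> ('a \<Rightarrow> 'a) set" where
  "idempotent_endos G =
     {f \<in> extensional (verts G). is_hom G G f \<and> (\<forall>x\<in>verts G. f (f x) = f x)}"

definition im :: "'a ep_struct \<Rightarrow> ('a \<Rightarrow> 'a) \<Rightarrow> 'a ep_struct" where
  "im G f =
     \<lparr>verts = f ` verts G,
      edges = {(f u, f v) | u v. (u, v) \<in> edges G},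
      parts = parts G \<inter> (f ` verts G \<times> f ` verts G)\<rparr>"

definition K11 :: "bool ep_struct" where
  "K11 = \<lparr>verts = {False, True}, edges = {(False, True), (True, False)},
          parts = {(False, False), (True, True)}\<rparr>"

end

theory Submission imports Defs begin

text \<open>The graph \<open>B\<close> has the one-point extension property. Hence any countable bipartite graph \<open>H\<close>
  embeds in \<open>B\<close> so sparsely that every vertex off the image has only finitely many neighbours in
  it. If \<open>\<Gamma>\<close> is algebraically closed, each homomorphism \<open>H \<rightarrow> \<Gamma>\<close> then extends to \<open>B\<close>, vertex by
  vertex along an enumeration, since at each step only finitely many constraints are present.
  Taking \<open>H\<close> to be \<open>\<Gamma>\<close> together with infinitely many isolated vertices in one part, the isolated
  vertices may be sent independently to either of two vertices of \<open>\<Gamma>\<close>, which produces \<open>2\<^sup>\<omega>\<close>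
  retractions unless both parts of \<open>\<Gamma>\<close> are singletons. In that last case the idempotent is
  determined by the edge that is its image.\<close>

section \<open>Isomorphisms and colourings\<close>

text \<open>Trades the \<open>inv_into\<close> clause of \<open>is_iso\<close> for reflection of
  both relations along \<open>f\<close>, the form in which most isomorphisms below are built and
  used.\<close>

lemma is_iso_iff:
  assumes "structure_on G" "structure_on H"
  shows "is_iso G H f \<longleftrightarrow> bij_betw f (verts G) (verts H) \<and>
    (\<forall>u\<in>verts G. \<forall>v\<in>verts G. ((f u, f v) \<in> edges H \<longleftrightarrow> (u, v) \<in> edges G) \<and>
                             ((f u, f v) \<in> parts H \<longleftrightarrow> (u, v) \<in> parts G))"
    (is "?L \<longleftrightarrow> ?R")
proof
  assume L: ?L
  let ?g = "inv_into (verts G) f"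
  have b: "bij_betw f (verts G) (verts H)" and h: "is_hom G H f" and i: "is_hom H G ?g"
    using L by (auto simp: is_iso_def)
  have gf: "?g (f u) = u" if "u \<in> verts G" for u
    using b that by (simp add: bij_betw_inv_into_left)
  show ?R
  proof (intro conjI ballI b)
    fix u v assume uv: "u \<in> verts G" "v \<in> verts G"
    show "(f u, f v) \<in> edges H \<longleftrightarrow> (u, v) \<in> edges G"
      using h i gf[OF uv(1)] gf[OF uv(2)] unfolding is_hom_def by metis
    show "(f u, f v) \<in> parts H \<longleftrightarrow> (u, v) \<in> parts G"
      using h i gf[OF uv(1)] gf[OF uv(2)] unfolding is_hom_def by metis
  qed
next
  assume R: ?R
  let ?g = "inv_into (verts G) f"
  have b: "bij_betw f (verts G) (verts H)" using R by simp
  have fg: "f (?g u) = u" "?g u \<in> verts G" if "u \<in> verts H" for u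
    using b that by (auto simp: bij_betw_inv_into_right bij_betw_def inv_into_into)
  have "is_hom G H f"
    unfolding is_hom_def using R assms by (auto simp: structure_on_def bij_betw_def)
  moreover have "is_hom H G ?g"
    unfolding is_hom_def
  proof (intro conjI allI impI)
    show "?g \<in> verts H \<rightarrow> verts G" using fg by auto
    fix u v
    show "(?g u, ?g v) \<in> edges G" if uv: "(u, v) \<in> edges H"
    proof -
      have "u \<in> verts H" "v \<in> verts H" using uv assms(2) by (auto simp: structure_on_def)
      then show ?thesis using R fg uv by metis
    qed
    show "(?g u, ?g v) \<in> parts G" if uv: "(u, v) \<in> parts H"
    proof -
      have "u \<in> verts H" "v \<in> verts H" using uv assms(2) by (auto simp: structure_on_def)
      then show ?thesis using R fg uv by metis
    qed
  qed
  ultimately show ?L using b by (simp add: is_iso_def)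
qed

lemma isomorphic_sym:
  assumes "structure_on G" "structure_on H" "isomorphic G H"
  shows "isomorphic H G"
proof -
  obtain f where f: "is_iso G H f" using assms by (auto simp: isomorphic_def)
  have b: "bij_betw f (verts G) (verts H)" using f by (simp add: is_iso_def)
  let ?g = "inv_into (verts G) f"
  have fg: "f (?g u) = u" "?g u \<in> verts G" if "u \<in> verts H" for u
    using b that by (auto simp: bij_betw_inv_into_right bij_betw_def inv_into_into)
  have "is_iso H G ?g"
    unfolding is_iso_iff[OF assms(2,1)]
    using f[unfolded is_iso_iff[OF assms(1,2)]] fg bij_betw_inv_into[OF b] by metis
  then show ?thesis by (auto simp: isomorphic_def)
qed

lemma isomorphic_trans:
  assumes "structure_on G" "structure_on H" "structure_on K" "isomorphic G H" "isomorphic H K"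
  shows "isomorphic G K"
proof -
  obtain f g where f: "is_iso G H f" and g: "is_iso H K g"
    using assms by (auto simp: isomorphic_def)
  have "f u \<in> verts H" if "u \<in> verts G" for u
    using f that by (auto simp: is_iso_def bij_betw_def)
  then have "is_iso G K (g \<circ> f)"
    using f g unfolding is_iso_iff[OF assms(1,2)] is_iso_iff[OF assms(2,3)] is_iso_iff[OF assms(1,3)]
    by (auto intro: bij_betw_trans)
  then show ?thesis by (auto simp: isomorphic_def)
qed

lemma structure_on_induced [simp]: "structure_on (induced G S)"
  by (auto simp: structure_on_def induced_def)

lemma structure_on_im: "is_hom G G f \<Longrightarrow> structure_on G \<Longrightarrow> structure_on (im G f)"
  by (auto simp: structure_on_def im_def)

lemma structure_on_K11: "structure_on K11"
  by (auto simp: structure_on_def K11_def)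

section \<open>Bipartite graphs with labelled parts\<close>

text \<open>\<open>parts\<close> determines the two parts only up to a swap, while the constructions
  below must say in which part a new vertex lies; the colour names the part. Irreflexivity of
  \<open>edges\<close> is implied by the last clause.\<close>

definition two_colouring :: "'a ep_struct \<Rightarrow> ('a \<Rightarrow> bool) \<Rightarrow> bool" where
  "two_colouring G c \<longleftrightarrow> structure_on G \<and> sym (edges G) \<and>
     (\<forall>u v. (u, v) \<in> parts G \<longleftrightarrow> u \<in> verts G \<and> v \<in> verts G \<and> c u = c v) \<and>
     (\<forall>u v. (u, v) \<in> edges G \<longrightarrow> c u \<noteq> c v)"

lemma bipartite_graph_iff_two_colouring: "bipartite_graph G \<longleftrightarrow> (\<exists>c. two_colouring G c)"
proof
  assume G: "bipartite_graph G"
  then obtain V0 V1 where V: "verts G = V0 \<union> V1" "V0 \<inter> V1 = {}"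
      "parts G = (V0 \<times> V0) \<union> (V1 \<times> V1)"
    by (auto simp: bipartite_graph_def)
  have "two_colouring G (\<lambda>v. v \<in> V0)"
    using G V unfolding two_colouring_def bipartite_graph_def structure_on_def by auto
  then show "\<exists>c. two_colouring G c" by blast
next
  assume "\<exists>c. two_colouring G c"
  then obtain c where c: "two_colouring G c" ..
  let ?V0 = "{v \<in> verts G. c v}" and ?V1 = "{v \<in> verts G. \<not> c v}"
  have "verts G = ?V0 \<union> ?V1" "?V0 \<inter> ?V1 = {}" by auto
  moreover have "parts G = (?V0 \<times> ?V0) \<union> (?V1 \<times> ?V1)"
    using c by (auto simp: two_colouring_def)
  ultimately have "\<exists>V0 V1. verts G = V0 \<union> V1 \<and> V0 \<inter> V1 = {} \<and> parts G = (V0 \<times> V0) \<union> (V1 \<times> V1)"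
    by blast
  then show "bipartite_graph G"
    using c unfolding bipartite_graph_def two_colouring_def irrefl_def by blast
qed

lemma bipartite_graph_isomorphic:
  assumes "isomorphic G H" "structure_on G" "bipartite_graph H"
  shows "bipartite_graph G"
proof -
  obtain c where c: "two_colouring H c"
    using assms bipartite_graph_iff_two_colouring by blast
  then have sH: "structure_on H" by (simp add: two_colouring_def)
  obtain f where f: "is_iso G H f" using assms by (auto simp: isomorphic_def)
  have fv: "f u \<in> verts H" if "u \<in> verts G" for u
    using f that by (auto simp: is_iso_def bij_betw_def)
  have E: "(u, v) \<in> edges G \<longleftrightarrow> u \<in> verts G \<and> v \<in> verts G \<and> (f u, f v) \<in> edges H" for u v
    using f assms(2) unfolding is_iso_iff[OF assms(2) sH] by (auto simp: structure_on_def)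
  have P: "(u, v) \<in> parts G \<longleftrightarrow> u \<in> verts G \<and> v \<in> verts G \<and> (f u, f v) \<in> parts H" for u v
    using f assms(2) unfolding is_iso_iff[OF assms(2) sH] by (auto simp: structure_on_def)
  have "two_colouring G (c \<circ> f)"
    using c fv assms(2) unfolding two_colouring_def sym_def E P by auto
  then show ?thesis using bipartite_graph_iff_two_colouring by blast
qed

text \<open>The extension axiom of the countable random bipartite graph. The colour \<open>k\<close>
  is a separate parameter because \<open>U\<close> may be empty, and then nothing else says in which
  part \<open>v\<close> is sought.\<close>

definition one_point_extension :: "'a ep_struct \<Rightarrow> ('a \<Rightarrow> bool) \<Rightarrow> bool" where
  "one_point_extension G c \<longleftrightarrow>
     (\<forall>S U k. finite S \<and> S \<subseteq> verts G \<and> U \<subseteq> S \<and> (\<forall>u\<in>U. c u = k) \<longrightarrow>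
        (\<exists>v\<in>verts G - S. c v \<noteq> k \<and> (\<forall>s\<in>S. (s, v) \<in> edges G \<longleftrightarrow> s \<in> U)))"

section \<open>The universal bipartite graph\<close>

text \<open>\<open>age\<close> consists of structures on natural numbers, so a finite piece of
  \<open>B\<close> is first copied along an injection into \<open>nat\<close>; the copy lies in the
  age and is therefore bipartite.\<close>

lemma universal_finite_induced:
  assumes B: "universal_bipartite_graph B" and S: "finite S" "S \<subseteq> verts B"
  shows "bipartite_graph (induced B S)"
proof -
  obtain g :: "'a \<Rightarrow> nat" where g: "inj_on g S"
    using finite_imp_inj_to_nat_seg[OF S(1)] by auto
  define F where "F = \<lparr>verts = g ` S, edges = {(g u, g v) | u v. u \<in> S \<and> v \<in> S \<and> (u, v) \<in> edges B},
    parts = {(g u, g v) | u v. u \<in> S \<and> v \<in> S \<and> (u, v) \<in> parts B}\<rparr>"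
  have sF: "structure_on F" by (auto simp: F_def structure_on_def)
  have "is_iso (induced B S) F g"
    unfolding is_iso_iff[OF structure_on_induced sF]
    using g by (auto simp: F_def induced_def bij_betw_def dest: inj_onD)
  then have SF: "isomorphic (induced B S) F" by (auto simp: isomorphic_def)
  then have "F \<in> age B"
    using sF S isomorphic_sym[OF structure_on_induced sF] by (auto simp: age_def F_def)
  then have "bipartite_graph F"
    using B by (auto simp: universal_bipartite_graph_def fraisse_limit_def)
  then show ?thesis using SF bipartite_graph_isomorphic structure_on_induced by blast
qed

text \<open>So far bipartiteness is known only for finite pieces of \<open>B\<close>. With the part
  of \<open>a\<close> as one colour class, each condition on the colouring concerns at most two
  vertices besides \<open>a\<close>, so it can be checked in the piece on
  \<open>{a, u, v}\<close>.\<close>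

lemma universal_two_colouring:
  assumes B: "universal_bipartite_graph B" and a: "a \<in> verts B"
  shows "two_colouring B (\<lambda>v. (a, v) \<in> parts B)"
proof -
  have sB: "structure_on B"
    using B by (auto simp: universal_bipartite_graph_def fraisse_limit_def)
  have loc: "((u, v) \<in> parts B \<longleftrightarrow> ((a, u) \<in> parts B) = ((a, v) \<in> parts B)) \<and>
     ((u, v) \<in> edges B \<longrightarrow> (v, u) \<in> edges B \<and> ((a, u) \<in> parts B) \<noteq> ((a, v) \<in> parts B))"
    if uv: "u \<in> verts B" "v \<in> verts B" for u v
  proof -
    obtain c where c: "two_colouring (induced B {a, u, v}) c"
      using universal_finite_induced[OF B, of "{a, u, v}"] a uv
      by (auto simp: bipartite_graph_iff_two_colouring)
    have p: "(x, y) \<in> parts B \<longleftrightarrow> c x = c y" if "x \<in> {a, u, v}" "y \<in> {a, u, v}" for x y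
      using c that unfolding two_colouring_def induced_def by auto
    have e: "(u, v) \<in> edges B \<longrightarrow> (v, u) \<in> edges B \<and> c u \<noteq> c v"
      using c unfolding two_colouring_def induced_def sym_def by auto
    show ?thesis using p[of u v] p[of a u] p[of a v] e by auto
  qed
  have E: "(u, v) \<in> edges B \<Longrightarrow> u \<in> verts B \<and> v \<in> verts B"
    and P: "(u, v) \<in> parts B \<Longrightarrow> u \<in> verts B \<and> v \<in> verts B" for u v
    using sB by (auto simp: structure_on_def)
  show ?thesis
    unfolding two_colouring_def sym_def using sB E P loc by metis
qed

lemma universal_nonempty:
  assumes B: "universal_bipartite_graph B"
  shows "verts B \<noteq> {}"
proof -
  define F :: "nat ep_struct" where "F = \<lparr>verts = {0}, edges = {}, parts = {(0, 0)}\<rparr>"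
  have "two_colouring F (\<lambda>_. True)"
    by (auto simp: F_def two_colouring_def structure_on_def sym_def)
  then have "F \<in> age B"
    using B by (auto simp: universal_bipartite_graph_def fraisse_limit_def
        bipartite_graph_iff_two_colouring F_def)
  then show ?thesis
    by (auto simp: age_def isomorphic_def is_iso_def F_def induced_def bij_betw_def)
qed

text \<open>The usual argument for homogeneous structures: add a point to a finite copy of
  \<open>S\<close>, embed the result in \<open>B\<close> through the age, and move the copy of
  \<open>S\<close> back onto \<open>S\<close> by an automorphism. Embeddings and automorphisms may
  swap parts, so the side of the new vertex is recorded relative to a vertex \<open>a\<close> of
  \<open>S\<close>, whose copy is moved back to \<open>a\<close>.\<close>

lemma universal_extension_vertex:
  assumes B: "universal_bipartite_graph B" and S: "finite S" "S \<subseteq> verts B"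
    and a: "a \<in> S" and U: "U \<subseteq> S" "\<forall>u\<in>U. (a, u) \<in> parts B"
  shows "\<exists>v\<in>verts B - S. (a, v) \<notin> parts B \<and> (\<forall>s\<in>S. (s, v) \<in> edges B \<longleftrightarrow> s \<in> U)"
proof -
  define c where "c = (\<lambda>v. (a, v) \<in> parts B)"
  have c: "two_colouring B c"
    unfolding c_def using universal_two_colouring[OF B] a S by blast
  have sB: "structure_on B" using c by (simp add: two_colouring_def)
  have "(a, a) \<in> parts B" using c a S by (auto simp: two_colouring_def)
  then have ca: "c a" by (simp add: c_def)
  obtain g :: "'a \<Rightarrow> nat" where g: "inj_on g S"
    using finite_imp_inj_to_nat_seg[OF S(1)] by auto
  obtain n where n: "n \<notin> g ` S"
    using S(1) ex_new_if_finite infinite_UNIV_nat by blast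
  \<comment> \<open>\<open>d\<close> is \<open>c\<close> transported along \<open>g\<close>, with
    value \<open>False\<close> at the new point \<open>n\<close>. As \<open>c a\<close> holds,
    \<open>n\<close> falls in the part opposite to the copy of \<open>a\<close>.\<close>
  define d where "d m \<longleftrightarrow> (\<exists>s\<in>S. m = g s \<and> c s)" for m
  have dg: "d (g s) \<longleftrightarrow> c s" if "s \<in> S" for s
    using that g by (auto simp: d_def dest: inj_onD)
  have dn: "\<not> d n" using n by (auto simp: d_def)
  define F where "F = \<lparr>verts = insert n (g ` S),
    edges = {(g u, g v) | u v. u \<in> S \<and> v \<in> S \<and> (u, v) \<in> edges B} \<union>
       {(g u, n) | u. u \<in> U} \<union> {(n, g u) | u. u \<in> U},
    parts = {(u, v). u \<in> insert n (g ` S) \<and> v \<in> insert n (g ` S) \<and> d u = d v}\<rparr>"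
  have cU: "c u" "u \<in> S" if "u \<in> U" for u using U that by (auto simp: c_def)
  have sF: "structure_on F" using U by (auto simp: F_def structure_on_def)
  have sy: "(v, u) \<in> edges B" "c u \<noteq> c v" if "(u, v) \<in> edges B" for u v
    using c that by (auto simp: two_colouring_def sym_def)
  have "two_colouring F d"
    unfolding two_colouring_def
  proof (intro conjI sF)
    show "sym (edges F)" using sy(1) by (simp add: F_def sym_def) blast
    show "\<forall>u v. (u, v) \<in> edges F \<longrightarrow> d u \<noteq> d v"
      using sy(2) by (auto simp: F_def dg dn cU)
  qed (auto simp: F_def)
  then have "F \<in> age B"
    using B S by (auto simp: universal_bipartite_graph_def fraisse_limit_def
        bipartite_graph_iff_two_colouring F_def)
  then obtain T \<phi> where T: "T \<subseteq> verts B" and \<phi>: "is_iso F (induced B T) \<phi>"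
    by (auto simp: age_def isomorphic_def)
  note \<phi>' = \<phi>[unfolded is_iso_iff[OF sF structure_on_induced]]
  have b\<phi>: "bij_betw \<phi> (insert n (g ` S)) T" using \<phi>' by (simp add: F_def induced_def)
  have vT: "\<phi> x \<in> T" if "x \<in> insert n (g ` S)" for x
    using b\<phi> that by (auto simp: bij_betw_def)
  have E\<phi>: "(\<phi> x, \<phi> y) \<in> edges B \<longleftrightarrow> (x, y) \<in> edges F"
    and P\<phi>: "(\<phi> x, \<phi> y) \<in> parts B \<longleftrightarrow> d x = d y"
    if xy: "x \<in> insert n (g ` S)" "y \<in> insert n (g ` S)" for x y
  proof -
    have "x \<in> verts F" "y \<in> verts F" using xy by (auto simp: F_def)
    then have "((\<phi> x, \<phi> y) \<in> edges (induced B T) \<longleftrightarrow> (x, y) \<in> edges F) \<and>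
        ((\<phi> x, \<phi> y) \<in> parts (induced B T) \<longleftrightarrow> (x, y) \<in> parts F)"
      using \<phi>' by blast
    moreover have "(x, y) \<in> parts F \<longleftrightarrow> d x = d y" using xy by (auto simp: F_def)
    ultimately show "(\<phi> x, \<phi> y) \<in> edges B \<longleftrightarrow> (x, y) \<in> edges F"
      "(\<phi> x, \<phi> y) \<in> parts B \<longleftrightarrow> d x = d y"
      using vT xy by (auto simp: induced_def)
  qed
  define h where "h = \<phi> \<circ> g"
  define T' where "T' = h ` S"
  have T': "T' \<subseteq> verts B" "finite T'" using vT T S by (auto simp: T'_def h_def)
  have bh: "bij_betw h S T'"
    unfolding T'_def bij_betw_def h_def
    using g b\<phi> by (auto simp: bij_betw_def intro!: comp_inj_on intro: inj_on_subset)
  have gE: "(g s, g t) \<in> edges F \<longleftrightarrow> (s, t) \<in> edges B" if "s \<in> S" "t \<in> S" for s t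
    using that n U by (auto simp: F_def dest: inj_onD[OF g])
  have gn: "(g s, n) \<in> edges F \<longleftrightarrow> s \<in> U" if "s \<in> S" for s
    using that n U by (auto simp: F_def dest: inj_onD[OF g])
  have hE: "(h s, h t) \<in> edges B \<longleftrightarrow> (s, t) \<in> edges B" if "s \<in> S" "t \<in> S" for s t
    using that by (simp add: h_def E\<phi> gE)
  have hP: "(h s, h t) \<in> parts B \<longleftrightarrow> (s, t) \<in> parts B" if st: "s \<in> S" "t \<in> S" for s t
  proof -
    have "(s, t) \<in> parts B \<longleftrightarrow> c s = c t"
      using c S(2) st unfolding two_colouring_def by blast
    then show ?thesis using st by (simp add: h_def P\<phi> dg)
  qed
  \<comment> \<open>\<open>T'\<close> is the copy of \<open>S\<close> found in \<open>B\<close>.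
    Homogeneity extends the map from \<open>T'\<close> back to \<open>S\<close> to an automorphism
    \<open>\<alpha>\<close>, and \<open>\<alpha> (\<phi> n)\<close> is the vertex sought.\<close>
  have isoh: "is_iso (induced B T') (induced B S) (inv_into S h)"
    unfolding is_iso_iff[OF structure_on_induced structure_on_induced]
  proof (intro conjI ballI)
    show "bij_betw (inv_into S h) (verts (induced B T')) (verts (induced B S))"
      using bij_betw_inv_into[OF bh] by (simp add: induced_def)
    fix u v assume "u \<in> verts (induced B T')" "v \<in> verts (induced B T')"
    then obtain s t where "s \<in> S" "t \<in> S" "u = h s" "v = h t"
      by (auto simp: induced_def T'_def)
    moreover from this have "inv_into S h u = s" "inv_into S h v = t"
      using bij_betw_inv_into_left[OF bh] by auto
    ultimately show "(inv_into S h u, inv_into S h v) \<in> edges (induced B S) \<longleftrightarrow>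
          (u, v) \<in> edges (induced B T')"
      "(inv_into S h u, inv_into S h v) \<in> parts (induced B S) \<longleftrightarrow>
          (u, v) \<in> parts (induced B T')"
      by (auto simp: induced_def T'_def hE hP)
  qed
  obtain \<alpha> where \<alpha>: "is_iso B B \<alpha>" and \<alpha>T: "\<forall>x\<in>T'. \<alpha> x = inv_into S h x"
    using B isoh S T' unfolding universal_bipartite_graph_def fraisse_limit_def homogeneous_def
    by blast
  have \<alpha>h: "\<alpha> (\<phi> (g s)) = s" if "s \<in> S" for s
    using \<alpha>T that bh by (auto simp: T'_def h_def bij_betw_def inv_into_f_f)
       (metis comp_apply inv_into_f_f)
  note \<alpha>' = \<alpha>[unfolded is_iso_iff[OF sB sB]]
  let ?v = "\<alpha> (\<phi> n)"
  have n\<phi>: "\<phi> n \<in> verts B" using vT T by auto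
  have g\<phi>: "\<phi> (g s) \<in> verts B" if "s \<in> S" for s using vT T that by auto
  have v: "?v \<in> verts B" using \<alpha>' n\<phi> by (auto simp: bij_betw_def)
  have "?v \<notin> S"
  proof
    assume vS: "?v \<in> S"
    then have "\<phi> (g ?v) = \<phi> n"
      using \<alpha>h[OF vS] \<alpha>' n\<phi> g\<phi>[OF vS] by (auto simp: bij_betw_def dest: inj_onD)
    then have "g ?v = n"
      using inj_onD[OF bij_betw_imp_inj_on[OF b\<phi>], of "g ?v" n] vS by auto
    then show False using n vS by (metis imageI)
  qed
  moreover have "(s, ?v) \<in> edges B \<longleftrightarrow> s \<in> U" if "s \<in> S" for s
  proof -
    have "(s, ?v) \<in> edges B \<longleftrightarrow> (\<phi> (g s), \<phi> n) \<in> edges B"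
      using \<alpha>' n\<phi> g\<phi>[OF that] \<alpha>h[OF that] by metis
    then show ?thesis using E\<phi>[of "g s" n] gn that by auto
  qed
  moreover have "(a, ?v) \<notin> parts B"
  proof -
    have "(a, ?v) \<in> parts B \<longleftrightarrow> (\<phi> (g a), \<phi> n) \<in> parts B"
      using \<alpha>' n\<phi> g\<phi>[OF a] \<alpha>h[OF a] by metis
    then show ?thesis using P\<phi>[of "g a" n] dg[OF a] dn ca a by auto
  qed
  ultimately show ?thesis using v by blast
qed

text \<open>Removes the anchor from the previous lemma: once both colours are known to occur, a
  vertex of the right colour can always be added to \<open>S\<close>.\<close>

lemma universal_one_point_extension:
  assumes B: "universal_bipartite_graph B"
  obtains c where "two_colouring B c" "one_point_extension B c"
proof -
  obtain a where a: "a \<in> verts B" using universal_nonempty[OF B] by blast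
  define c where "c = (\<lambda>v. (a, v) \<in> parts B)"
  have c: "two_colouring B c" unfolding c_def using universal_two_colouring[OF B a] .
  have pc: "(u, v) \<in> parts B \<longleftrightarrow> u \<in> verts B \<and> v \<in> verts B \<and> c u = c v" for u v
    using c by (simp add: two_colouring_def)
  obtain b where b: "b \<in> verts B" "(a, b) \<notin> parts B"
    using universal_extension_vertex[OF B, of "{a}" a "{}"] a by auto
  have "\<exists>x\<in>verts B. c x = k" for k
    using a b pc by (metis (full_types))
  then have "one_point_extension B c"
    unfolding one_point_extension_def
  proof (intro allI impI, elim conjE)
    fix S U k
    assume S: "finite S" "S \<subseteq> verts B" "U \<subseteq> S" "\<forall>u\<in>U. c u = k"
      and "\<And>k. \<exists>x\<in>verts B. c x = k"
    \<comment> \<open>\<open>S\<close> may contain no vertex of colour \<open>k\<close>, so such an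
      \<open>x\<close> is inserted as the anchor. If \<open>x\<close> is new, it lies outside
      \<open>U\<close> and merely adds one more nonadjacency.\<close>
    then obtain x where x: "x \<in> verts B" "c x = k" by blast
    have "\<exists>v\<in>verts B - insert x S. (x, v) \<notin> parts B \<and> (\<forall>s\<in>insert x S. (s, v) \<in> edges B \<longleftrightarrow> s \<in> U)"
      using S x pc by (intro universal_extension_vertex[OF B]) auto
    then show "\<exists>v\<in>verts B - S. c v \<noteq> k \<and> (\<forall>s\<in>S. (s, v) \<in> edges B \<longleftrightarrow> s \<in> U)"
      using x pc by auto
  qed
  then show ?thesis using c that by blast
qed

section \<open>Sparse embeddings and extension of homomorphisms\<close>

lemma finite_to_nat_on_less:
  "countable V \<Longrightarrow> finite {u \<in> V. to_nat_on V u < (n::nat)}"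
  by (rule finite_imageD[of "to_nat_on V"])
     (auto intro: finite_subset[of _ "{..<n}"] inj_on_subset[OF inj_on_to_nat_on])

text \<open>The vertices of \<open>H\<close> are placed along an enumeration. The image of
  \<open>x\<close> is chosen nonadjacent not only to the images of earlier non-neighbours but also
  to an initial segment of \<open>B\<close>, except for the prescribed neighbours. A vertex
  \<open>b\<close> off the image is then adjacent only to images chosen before its own index is
  reached.\<close>

lemma sparse_embedding:
  fixes B :: "'b ep_struct" and H :: "'a ep_struct"
  assumes c: "two_colouring B c" and ext: "one_point_extension B c" and cB: "countable (verts B)"
    and d: "two_colouring H d" and cH: "countable (verts H)"
  obtains e where "inj_on e (verts H)" "e ` verts H \<subseteq> verts B"
    "\<And>x. x \<in> verts H \<Longrightarrow> c (e x) = d x"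
    "\<And>x y. x \<in> verts H \<Longrightarrow> y \<in> verts H \<Longrightarrow> (e x, e y) \<in> edges B \<longleftrightarrow> (x, y) \<in> edges H"
    "\<And>b. b \<in> verts B - e ` verts H \<Longrightarrow> finite {u \<in> e ` verts H. (u, b) \<in> edges B}"
proof -
  let ?i = "to_nat_on (verts H)" and ?j = "to_nat_on (verts B)"
  define A where "A x = {y \<in> verts H. ?i y < ?i x}" for x
  \<comment> \<open>With \<open>Suc\<close>, a vertex \<open>b\<close> of \<open>B\<close> lies
    outside \<open>Z x\<close> exactly when \<open>?i x < ?j b\<close>, which is the bound used for
    finiteness at the end.\<close>
  define Z where "Z x = {b \<in> verts B. ?j b < Suc (?i x)}" for x
  define N where "N x = {y \<in> A x. (y, x) \<in> edges H}" for x
  \<comment> \<open>Vacuous off \<open>verts H\<close>, so that the recursion can run over the whole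
    type. Only the values of \<open>f\<close> on \<open>A x\<close>, that is at earlier vertices,
    are consulted.\<close>
  define P where "P f x v \<longleftrightarrow> (x \<in> verts H \<longrightarrow> v \<in> verts B \<and> c v = d x \<and>
      v \<notin> f ` A x \<union> Z x \<and> (\<forall>s \<in> f ` A x \<union> Z x. (s, v) \<in> edges B \<longleftrightarrow> s \<in> f ` N x))"
    for f :: "'a \<Rightarrow> 'b" and x v
  have finA: "finite (A x)" and finZ: "finite (Z x)" for x
    using finite_to_nat_on_less[OF cH] finite_to_nat_on_less[OF cB]
    unfolding A_def Z_def by blast+
  have "\<exists>f. \<forall>x. P f x (f x)"
  proof (rule dependent_wf_choice[of "measure ?i"])
    show "wf (measure ?i)" by simp
    show "P f x r = P g x r" if "\<And>z. (z, x) \<in> measure ?i \<Longrightarrow> f z = g z" for f g x r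
    proof -
      have eq: "f z = g z" if "z \<in> A x" for z
        using that \<open>\<And>z. (z, x) \<in> measure ?i \<Longrightarrow> f z = g z\<close> by (auto simp: A_def)
      then have "f ` A x = g ` A x" "f ` N x = g ` N x"
        by (auto simp: N_def intro!: image_cong)
      then show ?thesis by (simp add: P_def)
    qed
    show "\<exists>r. P f x r" if IH: "\<And>y. (y, x) \<in> measure ?i \<Longrightarrow> P f y (f y)" for x f
    proof (cases "x \<in> verts H")
      case True
      have f: "f y \<in> verts B" "c (f y) = d y" if "y \<in> A x" for y
        using IH[of y] that by (auto simp: A_def P_def)
      \<comment> \<open>The neighbours of \<open>x\<close> have the opposite colour, so the
        extension property is applied with \<open>k = (\<not> d x)\<close>, which gives the new
        image the colour \<open>d x\<close>.\<close>
      have "\<forall>u\<in>f ` N x. c u = (\<not> d x)"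
        using f(2) d by (auto simp: N_def two_colouring_def)
      moreover have "f ` A x \<union> Z x \<subseteq> verts B" "f ` N x \<subseteq> f ` A x \<union> Z x" "finite (f ` A x \<union> Z x)"
        using f finA finZ by (auto simp: N_def Z_def)
      ultimately obtain v where "v \<in> verts B - (f ` A x \<union> Z x)" "c v \<noteq> (\<not> d x)"
          "\<forall>s\<in>f ` A x \<union> Z x. (s, v) \<in> edges B \<longleftrightarrow> s \<in> f ` N x"
        using ext unfolding one_point_extension_def by metis
      then show ?thesis unfolding P_def by blast
    qed (auto simp: P_def)
  qed
  then obtain e where e: "\<And>x. P e x (e x)" by blast
  have eV: "e x \<in> verts B" "c (e x) = d x" if "x \<in> verts H" for x
    using e[of x] that by (auto simp: P_def)
  have neq: "e y \<noteq> e x" if "x \<in> verts H" "y \<in> verts H" "?i y < ?i x" for x y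
  proof -
    have "e y \<in> e ` A x" using that by (auto simp: A_def)
    then show ?thesis using e[of x] that(1) by (auto simp: P_def)
  qed
  have lt: "?i y < ?i x \<or> ?i x < ?i y" if "x \<in> verts H" "y \<in> verts H" "x \<noteq> y" for x y
    using that inj_on_to_nat_on[OF cH] by (metis inj_onD linorder_neqE_nat)
  have inj: "inj_on e (verts H)"
    using lt neq by (metis inj_onI)
  have edge1: "(e y, e x) \<in> edges B \<longleftrightarrow> (y, x) \<in> edges H"
    if "x \<in> verts H" "y \<in> verts H" "?i y < ?i x" for x y
  proof -
    have y: "y \<in> A x" using that by (simp add: A_def)
    then have "(e y, e x) \<in> edges B \<longleftrightarrow> e y \<in> e ` N x"
      using e[of x] that(1) by (auto simp: P_def)
    also have "\<dots> \<longleftrightarrow> y \<in> N x"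
      using inj y by (intro inj_on_image_mem_iff) (auto simp: N_def A_def)
    finally show ?thesis using y by (simp add: N_def)
  qed
  have symB: "(u, v) \<in> edges B \<longleftrightarrow> (v, u) \<in> edges B" for u v
    using c by (auto simp: two_colouring_def sym_def)
  have symH: "(u, v) \<in> edges H \<longleftrightarrow> (v, u) \<in> edges H" for u v
    using d by (auto simp: two_colouring_def sym_def)
  have irr: "(u, u) \<notin> edges B" "(w, w) \<notin> edges H" for u w
    using c d by (auto simp: two_colouring_def)
  have edge: "(e x, e y) \<in> edges B \<longleftrightarrow> (x, y) \<in> edges H" if "x \<in> verts H" "y \<in> verts H" for x y
    using lt[OF that] edge1 symB symH irr that by (cases "x = y") metis+
  have "finite {u \<in> e ` verts H. (u, b) \<in> edges B}" if b: "b \<in> verts B - e ` verts H" for b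
  proof (rule finite_subset)
    show "{u \<in> e ` verts H. (u, b) \<in> edges B} \<subseteq> e ` {x \<in> verts H. ?i x < ?j b}"
    proof clarify
      fix x assume x: "x \<in> verts H" "(e x, b) \<in> edges B"
      \<comment> \<open>Inside \<open>Z x\<close> only images of neighbours of \<open>x\<close> are
        adjacent to \<open>e x\<close>, and \<open>b\<close> is no image at all.\<close>
      have "b \<notin> e ` N x" using b by (auto simp: N_def A_def)
      then have "b \<notin> Z x"
        using e[of x] x symB by (auto simp: P_def)
      then have "?i x < ?j b" using b by (auto simp: Z_def)
      then show "e x \<in> e ` {x \<in> verts H. ?i x < ?j b}" using x by auto
    qed
    show "finite (e ` {x \<in> verts H. ?i x < ?j b})"
      using finite_to_nat_on_less[OF cH] by blast
  qed
  then show ?thesis using that[of e] inj eV edge by blast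
qed

text \<open>For empty \<open>S\<close> the closure property does not control the part of the vertex
  found. Both colours occur, since some vertex exists and has a neighbour; inserting a vertex of
  colour \<open>k\<close> into \<open>S\<close> then forces the other colour.\<close>

lemma algebraically_closed_colour:
  assumes G: "algebraically_closed G" and c: "two_colouring G c"
    and S: "finite S" "S \<subseteq> verts G" "\<forall>s\<in>S. c s = k"
  shows "\<exists>v\<in>verts G. c v \<noteq> k \<and> (\<forall>s\<in>S. (s, v) \<in> edges G)"
proof -
  have ac: "\<exists>v\<in>verts G. \<forall>x\<in>S. (x, v) \<in> edges G"
    if "S \<subseteq> verts G" "finite S" "\<forall>x\<in>S. \<forall>y\<in>S. c x = c y" for S
  proof -
    have "\<forall>x\<in>S. \<forall>y\<in>S. (x, y) \<in> parts G"
      using c that unfolding two_colouring_def by blast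
    then show ?thesis using G that(1,2) unfolding algebraically_closed_def by blast
  qed
  have ec: "(u, v) \<in> edges G \<Longrightarrow> c u \<noteq> c v" for u v
    using c by (auto simp: two_colouring_def)
  obtain a where a: "a \<in> verts G" using ac[of "{}"] by auto
  then obtain b where b: "b \<in> verts G" "(a, b) \<in> edges G" using ac[of "{a}"] by auto
  obtain x where x: "x \<in> verts G" "c x = k"
    using a b ec by (metis (full_types))
  then obtain v where "v \<in> verts G" "\<forall>s\<in>insert x S. (s, v) \<in> edges G"
    using ac[of "insert x S"] S by auto
  then show ?thesis using ec x by (metis insertCI)
qed

text \<open>Values off \<open>D\<close> are chosen along an enumeration of \<open>B\<close>. At each
  vertex finitely many neighbours already have values: those in \<open>D\<close> by sparseness, the
  others by the enumeration. These values all lie in one part of \<open>G\<close>, so algebraic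
  closedness supplies a common neighbour.\<close>

lemma hom_extension:
  fixes B :: "'b ep_struct" and G :: "'a ep_struct"
  assumes c: "two_colouring B c" and cB: "countable (verts B)"
    and d: "two_colouring G d" and G: "algebraically_closed G"
    and D: "D \<subseteq> verts B" and fin: "\<And>b. b \<in> verts B - D \<Longrightarrow> finite {u \<in> D. (u, b) \<in> edges B}"
    and r0: "\<And>u. u \<in> D \<Longrightarrow> r0 u \<in> verts G \<and> d (r0 u) = c u"
    and r0E: "\<And>u v. u \<in> D \<Longrightarrow> v \<in> D \<Longrightarrow> (u, v) \<in> edges B \<Longrightarrow> (r0 u, r0 v) \<in> edges G"
  obtains r where "\<And>u. u \<in> D \<Longrightarrow> r u = r0 u" "\<And>u. u \<in> verts B \<Longrightarrow> r u \<in> verts G \<and> d (r u) = c u"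
    "\<And>u v. (u, v) \<in> edges B \<Longrightarrow> (r u, r v) \<in> edges G"
proof -
  let ?j = "to_nat_on (verts B)"
  \<comment> \<open>The neighbours of \<open>v\<close> whose values are settled before that of
    \<open>v\<close>. Those in \<open>D\<close> count whatever their index, because
    \<open>r0\<close> is given in advance; accordingly \<open>R\<close> replaces the recursive
    values by \<open>r0\<close> on \<open>D\<close>.\<close>
  define A where "A v = {u \<in> verts B. (u, v) \<in> edges B \<and> (u \<in> D \<or> ?j u < ?j v)}" for v
  define R where "R f u = (if u \<in> D then r0 u else f u)" for f u
  define P where "P f v w \<longleftrightarrow> (v \<in> verts B - D \<longrightarrow> w \<in> verts G \<and> d w = c v \<and>
      (\<forall>u \<in> A v. (R f u, w) \<in> edges G))" for f v w
  have "\<exists>f. \<forall>x. P f x (f x)"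
  proof (rule dependent_wf_choice[of "measure ?j"])
    show "wf (measure ?j)" by simp
    show "P f x r = P g x r" if "\<And>z. (z, x) \<in> measure ?j \<Longrightarrow> f z = g z" for f g x r
      using that by (auto simp: P_def A_def R_def)
    show "\<exists>r. P f x r" if IH: "\<And>y. (y, x) \<in> measure ?j \<Longrightarrow> P f y (f y)" for x f
    proof (cases "x \<in> verts B - D")
      case True
      have "A x \<subseteq> {u \<in> D. (u, x) \<in> edges B} \<union> {u \<in> verts B. ?j u < ?j x}"
        by (auto simp: A_def)
      then have "finite (A x)"
        using fin[OF True] finite_to_nat_on_less[OF cB, of "?j x"] by (meson finite_UnI finite_subset)
      moreover have RA: "R f u \<in> verts G \<and> d (R f u) = c u" if "u \<in> A x" for u
        using that r0 IH[of u] by (auto simp: R_def A_def P_def)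
      \<comment> \<open>Neighbours of \<open>x\<close> have the opposite colour and colours are
        preserved, so the common neighbour obtained has the colour \<open>c x\<close>.\<close>
      moreover have "d s = (\<not> c x)" if "s \<in> R f ` A x" for s
        using that RA c by (auto simp: A_def two_colouring_def)
      ultimately have "\<exists>w\<in>verts G. d w \<noteq> (\<not> c x) \<and> (\<forall>s\<in>R f ` A x. (s, w) \<in> edges G)"
        by (intro algebraically_closed_colour[OF G d]) auto
      then show ?thesis unfolding P_def by blast
    qed (auto simp: P_def)
  qed
  then obtain f where f: "\<And>x. P f x (f x)" by blast
  have symB: "(u, v) \<in> edges B \<Longrightarrow> (v, u) \<in> edges B" for u v
    using c by (auto simp: two_colouring_def sym_def)
  have symG: "(u, v) \<in> edges G \<Longrightarrow> (v, u) \<in> edges G" for u v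
    using d by (auto simp: two_colouring_def sym_def)
  have RV: "R f u \<in> verts G \<and> d (R f u) = c u" if "u \<in> verts B" for u
    using that r0 f[of u] by (auto simp: R_def P_def)
  have step: "(R f u, R f v) \<in> edges G" if "v \<in> verts B - D" "u \<in> A v" for u v
    using f[of v] that by (auto simp: P_def R_def)
  have "(R f u, R f v) \<in> edges G" if uv: "(u, v) \<in> edges B" for u v
  proof -
    have V: "u \<in> verts B" "v \<in> verts B" "u \<noteq> v"
      using uv c by (auto simp: two_colouring_def structure_on_def)
    then have "?j u < ?j v \<or> ?j v < ?j u"
      using inj_on_to_nat_on[OF cB] by (metis inj_onD linorder_neqE_nat)
    \<comment> \<open>Unless both ends lie in \<open>D\<close>, the end settled last lies off
      \<open>D\<close> and has the other end among its constraints.\<close>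
    then consider "u \<in> D" "v \<in> D" | "v \<notin> D" "u \<in> A v" | "u \<notin> D" "v \<in> A u"
      using V uv symB[OF uv] by (auto simp: A_def)
    then show ?thesis
    proof cases
      case 1 then show ?thesis using r0E uv by (simp add: R_def)
    next
      case 2 then show ?thesis using step V by blast
    next
      case 3 then show ?thesis using step V symG by blast
    qed
  qed
  then show ?thesis using that[of "R f"] RV by (simp add: R_def)
qed

section \<open>Counting retractions\<close>

text \<open>Each \<open>F A\<close> is a homomorphism from \<open>B\<close> to \<open>G\<close>
  followed by a fixed embedding of \<open>G\<close> into \<open>B\<close> of which it is a left
  inverse. The case \<open>x = y\<close> serves for mere existence, the case
  \<open>x \<noteq> y\<close> for counting.\<close>

lemma retraction_family:
  fixes B :: "'b ep_struct" and G :: "'a ep_struct"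
  assumes c: "two_colouring B c" and ext: "one_point_extension B c" and cB: "countable (verts B)"
    and d: "two_colouring G d" and G: "algebraically_closed G" and cG: "countable (verts G)"
    and xy: "x \<in> verts G" "y \<in> verts G" "d x = d y"
  obtains F :: "nat set \<Rightarrow> 'b \<Rightarrow> 'b"
  where "\<And>A. F A \<in> idempotent_endos B" "\<And>A. isomorphic (im B (F A)) G" "x \<noteq> y \<Longrightarrow> inj F"
proof -
  define dH where "dH = case_sum d (\<lambda>_::nat. d x)"
  define VH where "VH = Inl ` verts G \<union> range (Inr :: nat \<Rightarrow> 'a + nat)"
  define H where "H = \<lparr>verts = VH, edges = {(Inl u, Inl v) | u v. (u, v) \<in> edges G},
     parts = {(u, v). u \<in> VH \<and> v \<in> VH \<and> dH u = dH v}\<rparr>"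
  have H: "two_colouring H dH"
    using d by (auto simp: two_colouring_def H_def structure_on_def sym_def VH_def dH_def)
  have cH: "countable (verts H)" using cG by (auto simp: H_def VH_def)
  obtain e where e: "inj_on e (verts H)" "e ` verts H \<subseteq> verts B"
    "\<And>x. x \<in> verts H \<Longrightarrow> c (e x) = dH x"
    "\<And>x y. x \<in> verts H \<Longrightarrow> y \<in> verts H \<Longrightarrow> (e x, e y) \<in> edges B \<longleftrightarrow> (x, y) \<in> edges H"
    "\<And>b. b \<in> verts B - e ` verts H \<Longrightarrow> finite {u \<in> e ` verts H. (u, b) \<in> edges B}"
    using sparse_embedding[OF c ext cB H cH] by blast
  \<comment> \<open>The identity on the copy of \<open>G\<close>, while the isolated vertices spell
    out the membership in \<open>A\<close>. Colours are respected because \<open>x\<close> and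
    \<open>y\<close> share a part.\<close>
  define h where "h A = case_sum id (\<lambda>i::nat. if i \<in> A then x else y)" for A
  have hV: "h A u \<in> verts G \<and> d (h A u) = dH u" if "u \<in> verts H" for A u
    using that xy by (auto simp: H_def VH_def h_def dH_def split: if_splits)
  have hE: "(h A u, h A v) \<in> edges G" if "(u, v) \<in> edges H" for A u v
    using that by (auto simp: H_def h_def)
  have "\<exists>r. (\<forall>u\<in>verts H. r (e u) = h A u) \<and> (\<forall>u\<in>verts B. r u \<in> verts G \<and> d (r u) = c u) \<and>
    (\<forall>u v. (u, v) \<in> edges B \<longrightarrow> (r u, r v) \<in> edges G)" for A
  proof -
    define r0 where "r0 u = h A (inv_into (verts H) e u)" for u
    have r0e: "r0 (e u) = h A u" if "u \<in> verts H" for u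
      using that e(1) by (simp add: r0_def)
    obtain r where r: "\<And>u. u \<in> e ` verts H \<Longrightarrow> r u = r0 u"
      "\<And>u. u \<in> verts B \<Longrightarrow> r u \<in> verts G \<and> d (r u) = c u"
      "\<And>u v. (u, v) \<in> edges B \<Longrightarrow> (r u, r v) \<in> edges G"
    proof (rule hom_extension[OF c cB d G e(2,5), of r0])
      show "r0 u \<in> verts G \<and> d (r0 u) = c u" if "u \<in> e ` verts H" for u
        using that r0e hV e(3) by auto
      show "(r0 u, r0 v) \<in> edges G"
        if "u \<in> e ` verts H" "v \<in> e ` verts H" "(u, v) \<in> edges B" for u v
        using that r0e hE e(4) by auto
    qed auto
    then show ?thesis using r0e by (intro exI[of _ r]) auto
  qed
  then obtain r where r: "\<And>A u. u \<in> verts H \<Longrightarrow> r A (e u) = h A u"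
    "\<And>A u. u \<in> verts B \<Longrightarrow> r A u \<in> verts G \<and> d (r A u) = c u"
    "\<And>A u v. (u, v) \<in> edges B \<Longrightarrow> (r A u, r A v) \<in> edges G"
    by metis
  \<comment> \<open>The embedding of \<open>G\<close> does not depend on \<open>A\<close>, so all
    the maps \<open>F A\<close> have the same image.\<close>
  define k where "k u = e (Inl u)" for u
  have iH: "Inl u \<in> verts H" if "u \<in> verts G" for u using that by (simp add: H_def VH_def)
  have nH: "Inr i \<in> verts H" for i by (simp add: H_def VH_def)
  have k: "k u \<in> verts B" "c (k u) = d u" "r A (k u) = u" if "u \<in> verts G" for u A
    using iH[OF that] e(2,3) r(1) by (auto simp: k_def dH_def h_def)
  have kE: "(k u, k v) \<in> edges B \<longleftrightarrow> (u, v) \<in> edges G" if "u \<in> verts G" "v \<in> verts G" for u v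
    using e(4)[OF iH iH] that by (simp add: k_def H_def)
  have kinj: "inj_on k (verts G)"
    using k(3) by (metis inj_onI)
  have BV: "(u, v) \<in> edges B \<Longrightarrow> u \<in> verts B \<and> v \<in> verts B"
    and BP: "(u, v) \<in> parts B \<longleftrightarrow> u \<in> verts B \<and> v \<in> verts B \<and> c u = c v"
    and GV: "(w, z) \<in> edges G \<Longrightarrow> w \<in> verts G \<and> z \<in> verts G"
    and GP: "(w, z) \<in> parts G \<longleftrightarrow> w \<in> verts G \<and> z \<in> verts G \<and> d w = d z" for u v w z
    using c d unfolding two_colouring_def structure_on_def by blast+
  define F where "F A = restrict (\<lambda>v. k (r A v)) (verts B)" for A
  have FV: "F A v = k (r A v)" if "v \<in> verts B" for A v using that by (simp add: F_def)
  have Fk: "F A (k u) = k u" if "u \<in> verts G" for A u using k that by (simp add: F_def)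
  have hom: "is_hom B B (F A)" for A
    unfolding is_hom_def
  proof (intro conjI allI impI)
    show "F A \<in> verts B \<rightarrow> verts B" using r(2) k(1) by (auto simp: FV)
    show "(F A u, F A v) \<in> edges B" if "(u, v) \<in> edges B" for u v
      using BV[OF that] kE r(2) r(3)[OF that] by (simp add: FV)
    show "(F A u, F A v) \<in> parts B" if "(u, v) \<in> parts B" for u v
      using that r(2) k(1,2) unfolding BP by (simp add: FV)
  qed
  have idem: "F A \<in> idempotent_endos B" for A
    unfolding idempotent_endos_def using hom[of A] Fk r(2)
    by (auto simp: FV) (simp add: F_def)
  have FB: "F A ` verts B = k ` verts G" for A
  proof
    show "F A ` verts B \<subseteq> k ` verts G" using r(2) by (auto simp: FV)
    show "k ` verts G \<subseteq> F A ` verts B" using Fk k(1) by (metis image_subsetI image_eqI)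
  qed
  have iso: "isomorphic (im B (F A)) G" for A
  proof (rule isomorphic_sym)
    have sB: "structure_on B" using c by (simp add: two_colouring_def)
    show sG: "structure_on G" using d by (simp add: two_colouring_def)
    show sI: "structure_on (im B (F A))" using structure_on_im[OF hom sB] .
    \<comment> \<open>The edges of \<open>im\<close> are by definition only the images of edges.
      Here they agree with the induced ones, since \<open>F A\<close> fixes the ends of every edge
      of \<open>B\<close> inside its image.\<close>
    have iE: "(k u, k v) \<in> edges (im B (F A)) \<longleftrightarrow> (u, v) \<in> edges G"
      if uv: "u \<in> verts G" "v \<in> verts G" for u v
    proof
      assume "(k u, k v) \<in> edges (im B (F A))"
      then have "(k u, k v) \<in> edges B" using hom[of A] by (auto simp: im_def is_hom_def)
      then show "(u, v) \<in> edges G" using kE uv by simp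
    next
      assume "(u, v) \<in> edges G"
      then have "(k u, k v) \<in> edges B" using kE uv by simp
      then have "(F A (k u), F A (k v)) \<in> edges (im B (F A))" by (auto simp: im_def)
      then show "(k u, k v) \<in> edges (im B (F A))" using Fk uv by simp
    qed
    have "is_iso G (im B (F A)) k"
      unfolding is_iso_iff[OF sG sI]
      using iE kinj k by (auto simp: bij_betw_def im_def FB BP GP)
    then show "isomorphic G (im B (F A))" by (auto simp: isomorphic_def)
  qed
  have "inj F" if "x \<noteq> y"
  proof (rule injI)
    fix A A' assume "F A = F A'"
    then have eq: "F A (e (Inr i)) = F A' (e (Inr i))" for i by simp
    \<comment> \<open>The value at the \<open>i\<close>-th isolated vertex reveals whether
      \<open>i\<close> belongs to \<open>A\<close>.\<close>
    have "F A (e (Inr i)) = (if i \<in> A then k x else k y)" for i A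
      using nH[of i] e(2) r(1) by (auto simp: FV h_def)
    moreover have "k x \<noteq> k y" using kinj xy that by (auto dest: inj_onD)
    ultimately have "i \<in> A \<longleftrightarrow> i \<in> A'" for i using eq[of i] by (auto split: if_splits)
    then show "A = A'" by blast
  qed
  then show ?thesis using that idem iso by blast
qed

section \<open>Algebraic closedness of images\<close>

lemma algebraically_closed_isomorphic:
  assumes "structure_on G" "structure_on H" "isomorphic G H" "algebraically_closed G"
  shows "algebraically_closed H"
  unfolding algebraically_closed_def
proof (intro allI impI, elim conjE)
  fix S assume S: "S \<subseteq> verts H" "finite S" "\<forall>x\<in>S. \<forall>y\<in>S. (x, y) \<in> parts H"
  obtain f where "is_iso H G f" using isomorphic_sym assms by (auto simp: isomorphic_def)
  note f = this[unfolded is_iso_iff[OF assms(2,1)]]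
  have "f ` S \<subseteq> verts G" "finite (f ` S)" "\<forall>x\<in>f ` S. \<forall>y\<in>f ` S. (x, y) \<in> parts G"
    using S f by (auto simp: bij_betw_def subset_iff)
  then obtain v where v: "v \<in> verts G" "\<forall>x\<in>f ` S. (x, v) \<in> edges G"
    using assms(4) unfolding algebraically_closed_def by metis
  obtain w where w: "w \<in> verts H" "v = f w" using f v(1) unfolding bij_betw_def by blast
  have "(x, w) \<in> edges H" if "x \<in> S" for x
  proof -
    have "(f x, f w) \<in> edges G" "x \<in> verts H" using v(2) w(2) that S(1) by auto
    then show ?thesis using f w(1) by blast
  qed
  then show "\<exists>v\<in>verts H. \<forall>x\<in>S. (x, v) \<in> edges H" using w(1) by blast
qed

text \<open>If \<open>v\<close> is a common neighbour of \<open>S\<close> in \<open>B\<close>, then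
  \<open>f v\<close> is one in the image, because an idempotent \<open>f\<close> fixes
  \<open>S\<close> pointwise.\<close>

lemma algebraically_closed_im:
  assumes c: "two_colouring B c" and ext: "one_point_extension B c" and f: "f \<in> idempotent_endos B"
  shows "algebraically_closed (im B f)"
  unfolding algebraically_closed_def
proof (intro allI impI, elim conjE)
  fix S assume S: "S \<subseteq> verts (im B f)" "finite S" "\<forall>x\<in>S. \<forall>y\<in>S. (x, y) \<in> parts (im B f)"
  have fB: "f v \<in> verts B" "f (f v) = f v" if "v \<in> verts B" for v
    using f that by (auto simp: idempotent_endos_def is_hom_def)
  have SB: "S \<subseteq> verts B" and fS: "\<And>s. s \<in> S \<Longrightarrow> f s = s" using S(1) fB by (auto simp: im_def)
  have cc: "c x = c y" if "x \<in> S" "y \<in> S" for x y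
  proof -
    have "(x, y) \<in> parts B" using S(3) that by (auto simp: im_def)
    then show ?thesis using c by (simp add: two_colouring_def)
  qed
  have "\<exists>k. \<forall>u\<in>S. c u = k"
  proof (cases "S = {}")
    case False
    then obtain s where "s \<in> S" by blast
    then have "\<forall>u\<in>S. c u = c s" using cc by blast
    then show ?thesis by blast
  qed simp
  then obtain k where k: "\<forall>u\<in>S. c u = k" by blast
  then obtain v where v: "v \<in> verts B" "\<forall>s\<in>S. (s, v) \<in> edges B"
    using ext[unfolded one_point_extension_def, rule_format, of S S k] S(2) SB by auto
  then show "\<exists>v\<in>verts (im B f). \<forall>x\<in>S. (x, v) \<in> edges (im B f)"
    using fS by (intro bexI[of _ "f v"]) (force simp: im_def)+
qed

section \<open>Cardinality bounds and the exceptional graph \<open>K11\<close>\<close>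

text \<open>Algebraic closedness provides an edge, whose ends exhaust the two parts. The vertices of
  \<open>K11\<close> are truth values, so the colouring \<open>d\<close> is itself the
  isomorphism.\<close>

lemma singleton_parts_isomorphic_K11:
  assumes d: "two_colouring G d" and G: "algebraically_closed G"
    and sing: "\<And>x y. x \<in> verts G \<Longrightarrow> y \<in> verts G \<Longrightarrow> d x = d y \<Longrightarrow> x = y"
  shows "isomorphic G K11"
proof -
  obtain a where a: "a \<in> verts G" "d a"
    using algebraically_closed_colour[OF G d, of "{}" False] by auto
  then obtain b where b: "b \<in> verts G" "\<not> d b" "(a, b) \<in> edges G"
    using algebraically_closed_colour[OF G d, of "{a}" True] by auto
  have V: "verts G = {a, b}" using a b sing by blast
  have sG: "structure_on G" using d by (simp add: two_colouring_def)
  have "(b, a) \<in> edges G" "(a, a) \<notin> edges G" "(b, b) \<notin> edges G"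
    using d b(3) by (auto simp: two_colouring_def sym_def)
  moreover have P: "(u, v) \<in> parts G \<longleftrightarrow> d u = d v" if "u \<in> {a, b}" "v \<in> {a, b}" for u v
    using d that V by (auto simp: two_colouring_def)
  ultimately have "is_iso G K11 d"
    unfolding is_iso_iff[OF sG structure_on_K11]
    using V a b P by (auto simp: K11_def bij_betw_def)
  then show ?thesis by (auto simp: isomorphic_def)
qed

text \<open>Used to see that an endomorphism with image \<open>K11\<close> is constant on each part
  of \<open>B\<close>.\<close>

lemma isomorphic_K11_parts:
  assumes "isomorphic G K11" "structure_on G" "(u, v) \<in> parts G"
  shows "u = v"
proof -
  obtain f where "is_iso G K11 f" using assms by (auto simp: isomorphic_def)
  then have f: "inj_on f (verts G)" "(f u, f v) \<in> parts K11"
    using assms(3) by (auto simp: is_iso_def is_hom_def bij_betw_def)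
  moreover have "u \<in> verts G" "v \<in> verts G" using assms by (auto simp: structure_on_def)
  ultimately show ?thesis by (auto simp: K11_def dest: inj_onD)
qed

text \<open>A map is coded by its graph, read as a set of natural numbers through an enumeration of
  \<open>verts B\<close>. Extensionality makes the coding injective.\<close>

lemma lepoll_idempotent_endos:
  assumes V: "countable (verts B)"
  shows "idempotent_endos B \<lesssim> (UNIV :: nat set set)"
proof -
  let ?j = "to_nat_on (verts B)"
  let ?g = "\<lambda>f. (\<lambda>v. prod_encode (?j v, ?j (f v))) ` verts B"
  have "inj_on ?g (idempotent_endos B)"
  proof (rule inj_onI)
    fix f f' assume f: "f \<in> idempotent_endos B" "f' \<in> idempotent_endos B" and eq: "?g f = ?g f'"
    have "f v = f' v" if v: "v \<in> verts B" for v
    proof -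
      have "prod_encode (?j v, ?j (f v)) \<in> ?g f'" using v eq by blast
      then obtain w where w: "w \<in> verts B" "?j v = ?j w" "?j (f v) = ?j (f' w)" by auto
      moreover have "f v \<in> verts B" "f' w \<in> verts B"
        using f v w(1) by (auto simp: idempotent_endos_def is_hom_def)
      ultimately show ?thesis using v V by simp
    qed
    then show "f = f'" using f by (auto simp: idempotent_endos_def intro: extensionalityI)
  qed
  then show ?thesis unfolding lepoll_def by blast
qed

text \<open>Such an \<open>f\<close> is constant on each part, hence determined by its values at one
  vertex of each colour, which leaves countably many. Conversely a fixed vertex \<open>a\<close> has
  infinitely many neighbours \<open>v\<close>, and each edge from \<open>a\<close> to
  \<open>v\<close> carries a retraction.\<close>

lemma eqpoll_retractions_K11:
  fixes B :: "'b ep_struct"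
  assumes c: "two_colouring B c" and ext: "one_point_extension B c" and cB: "countable (verts B)"
  shows "{f \<in> idempotent_endos B. isomorphic (im B f) K11} \<approx> (UNIV :: nat set)" (is "?X \<approx> _")
proof -
  have sB: "structure_on B" using c by (simp add: two_colouring_def)
  have BP: "(u, v) \<in> parts B \<longleftrightarrow> u \<in> verts B \<and> v \<in> verts B \<and> c u = c v" for u v
    using c by (simp add: two_colouring_def)
  obtain a where a: "a \<in> verts B" "c a"
    using ext[unfolded one_point_extension_def, rule_format, of "{}" "{}" False] by auto
  define N where "N = {v \<in> verts B. (a, v) \<in> edges B}"
  have infN: "infinite N"
  proof
    assume "finite N"
    \<comment> \<open>A vertex outside \<open>N\<close> whose only neighbour in
      \<open>insert a N\<close> is \<open>a\<close> would itself belong to \<open>N\<close>.\<close>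
    then obtain v where "v \<in> verts B - insert a N" "\<forall>s\<in>insert a N. (s, v) \<in> edges B \<longleftrightarrow> s \<in> {a}"
      using ext[unfolded one_point_extension_def, rule_format, of "insert a N" "{a}" True] a
      by (auto simp: N_def)
    then show False by (auto simp: N_def)
  qed
  have cN: "\<not> c v" "v \<in> verts B" "(v, a) \<in> edges B" "(a, v) \<in> edges B" if "v \<in> N" for v
    using c that a by (auto simp: N_def two_colouring_def sym_def)
  obtain b where b: "b \<in> verts B" "\<not> c b"
    using infN cN(1,2) by (metis ex_in_conv finite.emptyI)
  have determined: "f v = (if c v then f a else f b)"
    if f: "f \<in> idempotent_endos B" "isomorphic (im B f) K11" and v: "v \<in> verts B" for f v
  proof -
    have h: "is_hom B B f" using f(1) by (simp add: idempotent_endos_def)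
    have "f v = f w" if w: "w \<in> verts B" "c v = c w" for w
    proof (rule isomorphic_K11_parts[OF f(2) structure_on_im[OF h sB]])
      have "(f v, f w) \<in> parts B" using h v w BP[of v w] unfolding is_hom_def by blast
      then show "(f v, f w) \<in> parts (im B f)" using v w by (simp add: im_def)
    qed
    then show ?thesis using a b by auto
  qed
  have "inj_on (\<lambda>f. (f a, f b)) ?X"
  proof (rule inj_onI)
    fix f g assume f: "f \<in> ?X" and g: "g \<in> ?X" and eq: "(f a, f b) = (g a, g b)"
    have "f v = g v" if "v \<in> verts B" for v
      using determined[of f v] determined[of g v] f g eq that by auto
    then show "f = g"
      using f g by (auto simp: idempotent_endos_def intro: extensionalityI)
  qed
  moreover have "(\<lambda>f. (f a, f b)) ` ?X \<subseteq> verts B \<times> verts B"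
    using a b by (auto simp: idempotent_endos_def is_hom_def)
  ultimately have cX: "countable ?X"
    using cB by (meson countable_SIGMA countable_image_inj_on countable_subset)
  \<comment> \<open>Folds the part of \<open>a\<close> onto \<open>a\<close> and the other part onto
    \<open>v\<close>; \<open>v\<close> is recovered as the value at \<open>b\<close>.\<close>
  define g where "g v = restrict (\<lambda>u. if c u then a else v) (verts B)" for v
  have gX: "g v \<in> ?X" if v: "v \<in> N" for v
  proof -
    note vN = cN[OF v]
    have edge: "u \<in> verts B \<and> w \<in> verts B \<and> c u \<noteq> c w" if "(u, w) \<in> edges B" for u w
      using that c by (auto simp: two_colouring_def structure_on_def)
    have h: "is_hom B B (g v)"
      unfolding is_hom_def using vN a by (auto simp: g_def BP dest!: edge)
    have idem: "g v \<in> idempotent_endos B"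
      unfolding idempotent_endos_def using h vN a by (auto simp: g_def)
    have ga: "g v a = a" "g v v = v" using a vN by (auto simp: g_def)
    have V: "verts (im B (g v)) = {a, v}"
      using a vN ga by (auto simp: im_def g_def image_iff split: if_splits)
    have sI: "structure_on (im B (g v))" using structure_on_im[OF h sB] .
    have E: "(a, v) \<in> edges (im B (g v))" "(v, a) \<in> edges (im B (g v))"
      using vN ga by (force simp: im_def)+
    have E': "c u \<noteq> c w" if "(u, w) \<in> edges (im B (g v))" for u w
    proof -
      have "(u, w) \<in> edges B" using that h by (auto simp: im_def is_hom_def)
      then show ?thesis using edge by blast
    qed
    have P: "(u, w) \<in> parts (im B (g v)) \<longleftrightarrow> c u = c w" if "u \<in> {a, v}" "w \<in> {a, v}" for u w
      using that V a vN by (auto simp: im_def BP)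
    have "(a, a) \<notin> edges (im B (g v))" "(v, v) \<notin> edges (im B (g v))" using E' by blast+
    \<comment> \<open>On the vertices \<open>a\<close> and \<open>v\<close> the colouring
      \<open>c\<close> takes the two truth values and so is the isomorphism.\<close>
    then have "is_iso (im B (g v)) K11 c"
      unfolding is_iso_iff[OF sI structure_on_K11] V
      using a vN E by (auto simp: K11_def bij_betw_def P)
    then show ?thesis using idem by (auto simp: isomorphic_def)
  qed
  have "inj_on g N"
  proof (rule inj_onI)
    fix u v assume "g u = g v"
    then have "g u b = g v b" by simp
    then show "u = v" using b by (simp add: g_def)
  qed
  then have "infinite ?X" using infN gX by (meson finite_subset finite_imageD image_subsetI)
  then show ?thesis using cX by (meson countableE_infinite eqpoll_def)
qed

section \<open>Combination of the three claims\<close>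

theorem theorem5p6:
  fixes B :: "'b ep_struct" and \<Gamma> :: "'a ep_struct"
  assumes "universal_bipartite_graph B"
    and "bipartite_graph \<Gamma>" and "countable (verts \<Gamma>)"
  shows "((\<exists>f \<in> idempotent_endos B. isomorphic (im B f) \<Gamma>) \<longleftrightarrow> algebraically_closed \<Gamma>)
    \<and> (algebraically_closed \<Gamma> \<and> \<not> isomorphic \<Gamma> K11 \<longrightarrow>
          {f \<in> idempotent_endos B. isomorphic (im B f) \<Gamma>} \<approx> (UNIV :: nat set set))
    \<and> (isomorphic \<Gamma> K11 \<longrightarrow>
          {f \<in> idempotent_endos B. isomorphic (im B f) \<Gamma>} \<approx> (UNIV :: nat set))"
proof -
  obtain c where c: "two_colouring B c" "one_point_extension B c"
    using universal_one_point_extension[OF assms(1)] by blast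
  have cB: "countable (verts B)"
    using assms(1) by (simp add: universal_bipartite_graph_def fraisse_limit_def)
  obtain d where d: "two_colouring \<Gamma> d"
    using assms(2) bipartite_graph_iff_two_colouring by blast
  have sB: "structure_on B" and sG: "structure_on \<Gamma>"
    using c d by (auto simp: two_colouring_def)
  have sI: "structure_on (im B f)" if "f \<in> idempotent_endos B" for f
    using that sB structure_on_im by (auto simp: idempotent_endos_def)
  let ?X = "{f \<in> idempotent_endos B. isomorphic (im B f) \<Gamma>}"
  have "algebraically_closed \<Gamma>" if "f \<in> idempotent_endos B" "isomorphic (im B f) \<Gamma>" for f
    using algebraically_closed_isomorphic[OF sI sG that(2)] algebraically_closed_im[OF c] that(1)
    by blast
  moreover have "\<exists>f \<in> idempotent_endos B. isomorphic (im B f) \<Gamma>" if G: "algebraically_closed \<Gamma>"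
  proof -
    obtain x where "x \<in> verts \<Gamma>"
      using algebraically_closed_colour[OF G d, of "{}"] by auto
    \<comment> \<open>Taking both distinguished vertices equal to \<open>x\<close> gives existence
      from a single vertex of \<open>\<Gamma>\<close>.\<close>
    then show ?thesis
      using retraction_family[OF c cB d G assms(3), of x x] by metis
  qed
  moreover have "?X \<approx> (UNIV :: nat set set)"
    if G: "algebraically_closed \<Gamma>" and nK: "\<not> isomorphic \<Gamma> K11"
  proof (rule lepoll_antisym)
    \<comment> \<open>Were all parts of \<open>\<Gamma>\<close> at most singletons,
      \<open>\<Gamma>\<close> would be \<open>K11\<close>; hence two distinct vertices share a part,
      and the family becomes injective.\<close>
    obtain x y where xy: "x \<in> verts \<Gamma>" "y \<in> verts \<Gamma>" "d x = d y" "x \<noteq> y"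
      using singleton_parts_isomorphic_K11[OF d G] nK by blast
    obtain F :: "nat set \<Rightarrow> 'b \<Rightarrow> 'b" where "\<And>A. F A \<in> ?X" "inj F"
      using retraction_family[OF c cB d G assms(3) xy(1-3)] xy(4)
      by (metis (mono_tags, lifting) mem_Collect_eq)
    then show "(UNIV :: nat set set) \<lesssim> ?X" unfolding lepoll_def by blast
    show "?X \<lesssim> (UNIV :: nat set set)"
      using lepoll_idempotent_endos[OF cB] by (rule lepoll_trans[OF subset_imp_lepoll, rotated]) blast
  qed
  moreover have "?X \<approx> (UNIV :: nat set)" if K: "isomorphic \<Gamma> K11"
  proof -
    have "?X = {f \<in> idempotent_endos B. isomorphic (im B f) K11}"
      using isomorphic_trans[OF sI sG structure_on_K11 _ K]
        isomorphic_trans[OF sI structure_on_K11 sG _ isomorphic_sym[OF sG structure_on_K11 K]]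
      by blast
    then show ?thesis using eqpoll_retractions_K11[OF c cB] by simp
  qed
  ultimately show ?thesis by blast
qed

end
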